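(* Let $\Gamma\subseteq\mathrm{Sent}(\mathscr{L}_\varepsilon)$ be a complete and consistent theory in an epsilon language $\mathscr{L}_\varepsilon$. Then the canonical model $(\mathfrak{M},f)$ of $\Gamma$ is atomic.
   Context: Epsilon language. $\mathsf{t}=(r_i,f_j,c_k)$ is a similarity type of relation, function and constant symbols. $\mathscr{L}_\varepsilon$ is the language with equality freely generated by $\neg,\vee,\varepsilon$ and $\mathsf{t}$: terms and formulae are defined simultaneously; variables, constants and $f_j(t_1,\dots,t_m)$ are terms, and for every formula $\varphi$ and variable $v_i$, $(\varepsilon v_i)\varphi$ is a term, in which $v_i$ is bound. $(\exists v_i)\varphi$ is $\varphi[(\varepsilon v_i)\varphi/v_i]$ and $(\forall v_i)\varphi$ is $\varphi[(\varepsilon v_i)\neg\varphi/v_i]$. $\mathrm{Sent}$ is the set of sentences; $\mathrm{Fm}_{v_i}(\mathscr{L}_\varepsilon)$ is the set of formulae with no free variable other than $v_i$. Calculus. $\vdash$ is provability in the extensional epsilon calculus: classical propositional logic with equality together with the axiom of transfinity $\varphi[t/v_i]\rightarrow\varphi[(\varepsilon v_i)\varphi/v_i]$ and the axiom of extensionality $(\forall v_i)(\varphi\leftrightarrow\psi)\rightarrow(\varepsilon v_i)\varphi=(\varepsilon v_i)\psi$. It is known to be complete with respect to choice structures. Choice structures. A choice function on $M$ is a function $f:\mathrm{Sb}(M)\to M$ on the power set with $f(S)\in S$ for every nonempty $S\subseteq M$ ($f(\emptyset)\in M$ arbitrary). A choice structure ($\mathscr{L}_\varepsilon$-model) is a pair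 $(\mathfrak{M},f)$ with $\mathfrak{M}$ a first-order $\mathsf{t}$-structure on $M$ and $f$ a choice function on $M$; evaluation is as usual, with $((\varepsilon v_i)\varphi)^{\mathfrak{M}f}[a]=f(\{m\in M\mid(\mathfrak{M},f)\models\varphi[a(v_i\mapsto m)]\})$. Canonical model. Let $\mathrm{Eps}_1=\{(\varepsilon v_i)\varphi\mid v_i \text{ a variable},\ \varphi\in\mathrm{Fm}_{v_i}(\mathscr{L}_\varepsilon)\}$; $t_1=_\Gamma t_2$ iff $\Gamma\vdash t_1=t_2$; $[t]_\Gamma$ is the class of $t$. The canonical model $(\mathfrak{M},f)$ of $\Gamma$ has universe $M=\mathrm{Eps}_1/\!=_\Gamma$ and interpretations: $([a_1]_\Gamma,\dots,[a_l]_\Gamma)\in r_i^{\mathfrak{M}}$ iff $\Gamma\vdash r_i(a_1,\dots,a_l)$; $f_j^{\mathfrak{M}}([a_1]_\Gamma,\dots,[a_m]_\Gamma)=[(\varepsilon v_0)(v_0=f_j(a_1,\dots,a_m))]_\Gamma$; $c_k^{\mathfrak{M}}=[(\varepsilon v_0)(v_0=c_k)]_\Gamma$. Its choice function satisfies $f(\{[t]_\Gamma\in M\mid\Gamma\vdash\varphi[t/v_i]\})=[(\varepsilon v_i)\varphi]_\Gamma$ for $\varphi\in\mathrm{Fm}_{v_i}(\mathscr{L}_\varepsilon)$, and is an arbitrary choice function on all other subsets. It is a model of $\Gamma$. Atomic. A model $(\mathfrak{M},f)$ is atomic if for every finite tuple $(m_1,\dots,m_n)$ of elements of $M$ there is an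 $\mathscr{L}_\varepsilon$-formula $\theta(v_1,\dots,v_n)$ satisfied by the tuple in $(\mathfrak{M},f)$ that is complete in $\mathrm{Th}(\mathfrak{M},f)$: for every $\mathscr{L}_\varepsilon$-formula $\varphi(v_1,\dots,v_n)$, exactly one of $\theta\rightarrow\varphi$, $\theta\rightarrow\neg\varphi$ follows from $\mathrm{Th}(\mathfrak{M},f)$. *)

theory Defs
  imports Main
begin

text \<open>
  A similarity type selects the symbols in use from the types \<open>'r\<close>, \<open>'f\<close>, \<open>'c\<close>; these are
  partial maps and sets (and not just arity functions on the types) so that there may be no
  symbols of some kind.
\<close>

record ('r, 'f, 'c) sim_type =
  rels :: "'r \<rightharpoonup> nat"
  funs :: "'f \<rightharpoonup> nat"
  consts_of :: "'c set"

datatype ('r, 'f, 'c) tm =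
    Var nat
  | Const 'c
  | Fun 'f "('r, 'f, 'c) tm list"
  | Eps nat "('r, 'f, 'c) fm"
and ('r, 'f, 'c) fm =
    Rel 'r "('r, 'f, 'c) tm list"
  | Eq "('r, 'f, 'c) tm" "('r, 'f, 'c) tm"
  | Neg "('r, 'f, 'c) fm"
  | Or "('r, 'f, 'c) fm" "('r, 'f, 'c) fm"

abbreviation Imp :: "('r, 'f, 'c) fm \<Rightarrow> ('r, 'f, 'c) fm \<Rightarrow> ('r, 'f, 'c) fm" where
  "Imp \<phi> \<psi> \<equiv> Or (Neg \<phi>) \<psi>"

abbreviation And :: "('r, 'f, 'c) fm \<Rightarrow> ('r, 'f, 'c) fm \<Rightarrow> ('r, 'f, 'c) fm" where
  "And \<phi> \<psi> \<equiv> Neg (Or (Neg \<phi>) (Neg \<psi>))"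

abbreviation Iff :: "('r, 'f, 'c) fm \<Rightarrow> ('r, 'f, 'c) fm \<Rightarrow> ('r, 'f, 'c) fm" where
  "Iff \<phi> \<psi> \<equiv> And (Imp \<phi> \<psi>) (Imp \<psi> \<phi>)"

fun wf_tm :: "('r, 'f, 'c) sim_type \<Rightarrow> ('r, 'f, 'c) tm \<Rightarrow> bool"
and wf_fm :: "('r, 'f, 'c) sim_type \<Rightarrow> ('r, 'f, 'c) fm \<Rightarrow> bool" where
  "wf_tm L (Var i) \<longleftrightarrow> True"
| "wf_tm L (Const c) \<longleftrightarrow> c \<in> consts_of L"
| "wf_tm L (Fun g ts) \<longleftrightarrow> funs L g = Some (length ts) \<and> (\<forall>t \<in> set ts. wf_tm L t)"
| "wf_tm L (Eps i \<phi>) \<longleftrightarrow> wf_fm L \<phi>"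
| "wf_fm L (Rel r ts) \<longleftrightarrow> rels L r = Some (length ts) \<and> (\<forall>t \<in> set ts. wf_tm L t)"
| "wf_fm L (Eq s t) \<longleftrightarrow> wf_tm L s \<and> wf_tm L t"
| "wf_fm L (Neg \<phi>) \<longleftrightarrow> wf_fm L \<phi>"
| "wf_fm L (Or \<phi> \<psi>) \<longleftrightarrow> wf_fm L \<phi> \<and> wf_fm L \<psi>"

fun fv_tm :: "('r, 'f, 'c) tm \<Rightarrow> nat set"
and fv_fm :: "('r, 'f, 'c) fm \<Rightarrow> nat set" where
  "fv_tm (Var i) = {i}"
| "fv_tm (Const c) = {}"
| "fv_tm (Fun g ts) = (\<Union>t \<in> set ts. fv_tm t)"
| "fv_tm (Eps i \<phi>) = fv_fm \<phi> - {i}"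
| "fv_fm (Rel r ts) = (\<Union>t \<in> set ts. fv_tm t)"
| "fv_fm (Eq s t) = fv_tm s \<union> fv_tm t"
| "fv_fm (Neg \<phi>) = fv_fm \<phi>"
| "fv_fm (Or \<phi> \<psi>) = fv_fm \<phi> \<union> fv_fm \<psi>"

text \<open>
  Simultaneous capture-avoiding substitution. A bound variable is renamed only if it would
  capture a variable of a substituted term, so that substituting closed terms, or variables
  for themselves, never renames.
\<close>

definition fresh_for :: "nat set \<Rightarrow> nat \<Rightarrow> nat" where
  "fresh_for X i = (if i \<notin> X then i else (LEAST j. j \<notin> X))"

fun subst_tm :: "(nat \<Rightarrow> ('r, 'f, 'c) tm) \<Rightarrow> ('r, 'f, 'c) tm \<Rightarrow> ('r, 'f, 'c) tm"
and subst_fm :: "(nat \<Rightarrow> ('r, 'f, 'c) tm) \<Rightarrow> ('r, 'f, 'c) fm \<Rightarrow> ('r, 'f, 'c) fm" where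
  "subst_tm \<sigma> (Var i) = \<sigma> i"
| "subst_tm \<sigma> (Const c) = Const c"
| "subst_tm \<sigma> (Fun g ts) = Fun g (map (subst_tm \<sigma>) ts)"
| "subst_tm \<sigma> (Eps i \<phi>) =
     (let j = fresh_for (\<Union>k \<in> fv_fm \<phi> - {i}. fv_tm (\<sigma> k)) i
      in Eps j (subst_fm (\<sigma>(i := Var j)) \<phi>))"
| "subst_fm \<sigma> (Rel r ts) = Rel r (map (subst_tm \<sigma>) ts)"
| "subst_fm \<sigma> (Eq s t) = Eq (subst_tm \<sigma> s) (subst_tm \<sigma> t)"
| "subst_fm \<sigma> (Neg \<phi>) = Neg (subst_fm \<sigma> \<phi>)"
| "subst_fm \<sigma> (Or \<phi> \<psi>) = Or (subst_fm \<sigma> \<phi>) (subst_fm \<sigma> \<psi>)"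

abbreviation inst :: "('r, 'f, 'c) fm \<Rightarrow> ('r, 'f, 'c) tm \<Rightarrow> nat \<Rightarrow> ('r, 'f, 'c) fm"
    ("_[_'/v _]" [1000, 0, 0] 1000) where
  "\<phi>[t/v i] \<equiv> subst_fm (Var(i := t)) \<phi>"

definition Ex :: "nat \<Rightarrow> ('r, 'f, 'c) fm \<Rightarrow> ('r, 'f, 'c) fm" where
  "Ex i \<phi> = \<phi>[Eps i \<phi>/v i]"

definition All :: "nat \<Rightarrow> ('r, 'f, 'c) fm \<Rightarrow> ('r, 'f, 'c) fm" where
  "All i \<phi> = \<phi>[Eps i (Neg \<phi>)/v i]"

definition Sent :: "('r, 'f, 'c) sim_type \<Rightarrow> ('r, 'f, 'c) fm set" where
  "Sent L = {\<phi>. wf_fm L \<phi> \<and> fv_fm \<phi> = {}}"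

definition Fm :: "('r, 'f, 'c) sim_type \<Rightarrow> nat \<Rightarrow> ('r, 'f, 'c) fm set" where
  "Fm L i = {\<phi>. wf_fm L \<phi> \<and> fv_fm \<phi> \<subseteq> {i}}"

definition tautology :: "('r, 'f, 'c) fm \<Rightarrow> bool" where
  "tautology \<phi> \<longleftrightarrow>
     (\<forall>V :: ('r, 'f, 'c) fm \<Rightarrow> bool.
        (\<forall>\<alpha>. V (Neg \<alpha>) \<longleftrightarrow> \<not> V \<alpha>) \<and> (\<forall>\<alpha> \<beta>. V (Or \<alpha> \<beta>) \<longleftrightarrow> V \<alpha> \<or> V \<beta>) \<longrightarrow> V \<phi>)"

text \<open>
  Axioms are all instances, open ones included, so that modus ponens suffices as a rule:
  from an open theorem \<open>\<phi>\<close> of a set of sentences one gets \<open>All i \<phi>\<close> as a theorem.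
  Equality of \<open>\<epsilon>\<close>-terms that differ in the name of the bound variable is derivable from
  \<open>eq_subst\<close> (where a substitution may force a renaming) and \<open>extensionality\<close>.
\<close>

inductive proves :: "('r, 'f, 'c) sim_type \<Rightarrow> ('r, 'f, 'c) fm set \<Rightarrow> ('r, 'f, 'c) fm \<Rightarrow> bool"
    ("_, _ \<turnstile> _" [60, 60, 60] 55)
  for L :: "('r, 'f, 'c) sim_type" and \<Gamma> :: "('r, 'f, 'c) fm set" where
  hyp: "\<phi> \<in> \<Gamma> \<Longrightarrow> wf_fm L \<phi> \<Longrightarrow> L, \<Gamma> \<turnstile> \<phi>"
| taut: "tautology \<phi> \<Longrightarrow> wf_fm L \<phi> \<Longrightarrow> L, \<Gamma> \<turnstile> \<phi>"
| eq_refl: "wf_tm L t \<Longrightarrow> L, \<Gamma> \<turnstile> Eq t t"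
| eq_subst: "wf_tm L s \<Longrightarrow> wf_tm L t \<Longrightarrow> wf_fm L \<phi> \<Longrightarrow>
    L, \<Gamma> \<turnstile> Imp (Eq s t) (Imp (\<phi>[s/v i]) (\<phi>[t/v i]))"
| transfinity: "wf_tm L t \<Longrightarrow> wf_fm L \<phi> \<Longrightarrow> L, \<Gamma> \<turnstile> Imp (\<phi>[t/v i]) (\<phi>[Eps i \<phi>/v i])"
| extensionality: "wf_fm L \<phi> \<Longrightarrow> wf_fm L \<psi> \<Longrightarrow>
    L, \<Gamma> \<turnstile> Imp (All i (Iff \<phi> \<psi>)) (Eq (Eps i \<phi>) (Eps i \<psi>))"
| mp: "L, \<Gamma> \<turnstile> Imp \<phi> \<psi> \<Longrightarrow> L, \<Gamma> \<turnstile> \<phi> \<Longrightarrow> L, \<Gamma> \<turnstile> \<psi>"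

definition consistent :: "('r, 'f, 'c) sim_type \<Rightarrow> ('r, 'f, 'c) fm set \<Rightarrow> bool" where
  "consistent L \<Gamma> \<longleftrightarrow> \<not> (\<exists>\<phi>. L, \<Gamma> \<turnstile> \<phi> \<and> L, \<Gamma> \<turnstile> Neg \<phi>)"

definition complete_theory :: "('r, 'f, 'c) sim_type \<Rightarrow> ('r, 'f, 'c) fm set \<Rightarrow> bool" where
  "complete_theory L \<Gamma> \<longleftrightarrow> (\<forall>\<phi> \<in> Sent L. L, \<Gamma> \<turnstile> \<phi> \<or> L, \<Gamma> \<turnstile> Neg \<phi>)"

record ('r, 'f, 'c, 'm) struct =
  univ :: "'m set"
  rel_of :: "'r \<Rightarrow> 'm list set"
  fun_of :: "'f \<Rightarrow> 'm list \<Rightarrow> 'm"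
  const_of :: "'c \<Rightarrow> 'm"

definition structure_for :: "('r, 'f, 'c) sim_type \<Rightarrow> ('r, 'f, 'c, 'm) struct \<Rightarrow> bool" where
  "structure_for L M \<longleftrightarrow>
     univ M \<noteq> {} \<and>
     (\<forall>r n. rels L r = Some n \<longrightarrow> rel_of M r \<subseteq> {ms. set ms \<subseteq> univ M \<and> length ms = n}) \<and>
     (\<forall>g n ms. funs L g = Some n \<and> set ms \<subseteq> univ M \<and> length ms = n \<longrightarrow> fun_of M g ms \<in> univ M) \<and>
     (\<forall>c \<in> consts_of L. const_of M c \<in> univ M)"

definition choice_function :: "'m set \<Rightarrow> ('m set \<Rightarrow> 'm) \<Rightarrow> bool" where
  "choice_function A f \<longleftrightarrow> (\<forall>S \<subseteq> A. f S \<in> A \<and> (S \<noteq> {} \<longrightarrow> f S \<in> S))"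

definition choice_structure ::
    "('r, 'f, 'c) sim_type \<Rightarrow> ('r, 'f, 'c, 'm) struct \<Rightarrow> ('m set \<Rightarrow> 'm) \<Rightarrow> bool" where
  "choice_structure L M f \<longleftrightarrow> structure_for L M \<and> choice_function (univ M) f"

fun eval :: "('r, 'f, 'c, 'm) struct \<Rightarrow> ('m set \<Rightarrow> 'm) \<Rightarrow> (nat \<Rightarrow> 'm) \<Rightarrow> ('r, 'f, 'c) tm \<Rightarrow> 'm"
and sat :: "('r, 'f, 'c, 'm) struct \<Rightarrow> ('m set \<Rightarrow> 'm) \<Rightarrow> (nat \<Rightarrow> 'm) \<Rightarrow> ('r, 'f, 'c) fm \<Rightarrow> bool" where
  "eval M f a (Var i) = a i"
| "eval M f a (Const c) = const_of M c"
| "eval M f a (Fun g ts) = fun_of M g (map (eval M f a) ts)"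
| "eval M f a (Eps i \<phi>) = f {m \<in> univ M. sat M f (a(i := m)) \<phi>}"
| "sat M f a (Rel r ts) \<longleftrightarrow> map (eval M f a) ts \<in> rel_of M r"
| "sat M f a (Eq s t) \<longleftrightarrow> eval M f a s = eval M f a t"
| "sat M f a (Neg \<phi>) \<longleftrightarrow> \<not> sat M f a \<phi>"
| "sat M f a (Or \<phi> \<psi>) \<longleftrightarrow> sat M f a \<phi> \<or> sat M f a \<psi>"

definition Th ::
    "('r, 'f, 'c) sim_type \<Rightarrow> ('r, 'f, 'c, 'm) struct \<Rightarrow> ('m set \<Rightarrow> 'm) \<Rightarrow> ('r, 'f, 'c) fm set" where
  "Th L M f = {\<phi> \<in> Sent L. \<forall>a. range a \<subseteq> univ M \<longrightarrow> sat M f a \<phi>}"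

definition Eps1 :: "('r, 'f, 'c) sim_type \<Rightarrow> ('r, 'f, 'c) tm set" where
  "Eps1 L = {Eps i \<phi> | i \<phi>. \<phi> \<in> Fm L i}"

definition eq_mod ::
    "('r, 'f, 'c) sim_type \<Rightarrow> ('r, 'f, 'c) fm set \<Rightarrow> (('r, 'f, 'c) tm \<times> ('r, 'f, 'c) tm) set" where
  "eq_mod L \<Gamma> = {(s, t). s \<in> Eps1 L \<and> t \<in> Eps1 L \<and> L, \<Gamma> \<turnstile> Eq s t}"

definition cls ::
    "('r, 'f, 'c) sim_type \<Rightarrow> ('r, 'f, 'c) fm set \<Rightarrow> ('r, 'f, 'c) tm \<Rightarrow> ('r, 'f, 'c) tm set" where
  "cls L \<Gamma> t = eq_mod L \<Gamma> `` {t}"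

definition canonical_structure ::
    "('r, 'f, 'c) sim_type \<Rightarrow> ('r, 'f, 'c) fm set \<Rightarrow> ('r, 'f, 'c, ('r, 'f, 'c) tm set) struct" where
  "canonical_structure L \<Gamma> =
     \<lparr>univ = Eps1 L // eq_mod L \<Gamma>,
      rel_of = (\<lambda>r. {map (cls L \<Gamma>) as | as. set as \<subseteq> Eps1 L \<and> L, \<Gamma> \<turnstile> Rel r as}),
      fun_of = (\<lambda>g ms. THE m. \<exists>as. set as \<subseteq> Eps1 L \<and> ms = map (cls L \<Gamma>) as \<and>
                                   m = cls L \<Gamma> (Eps 0 (Eq (Var 0) (Fun g as)))),
      const_of = (\<lambda>c. cls L \<Gamma> (Eps 0 (Eq (Var 0) (Const c))))\<rparr>"

text \<open>
  The choice function of a canonical model is prescribed on the definable sets only, hence a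
  predicate rather than a function of \<open>\<Gamma>\<close>.
\<close>

definition canonical_choice ::
    "('r, 'f, 'c) sim_type \<Rightarrow> ('r, 'f, 'c) fm set \<Rightarrow> (('r, 'f, 'c) tm set set \<Rightarrow> ('r, 'f, 'c) tm set) \<Rightarrow> bool"
  where
  "canonical_choice L \<Gamma> f \<longleftrightarrow>
     choice_function (univ (canonical_structure L \<Gamma>)) f \<and>
     (\<forall>i. \<forall>\<phi> \<in> Fm L i.
        f {cls L \<Gamma> t | t. t \<in> Eps1 L \<and> L, \<Gamma> \<turnstile> \<phi>[t/v i]} = cls L \<Gamma> (Eps i \<phi>))"

definition canonical_model ::
    "('r, 'f, 'c) sim_type \<Rightarrow> ('r, 'f, 'c) fm set \<Rightarrow> ('r, 'f, 'c, ('r, 'f, 'c) tm set) struct \<Rightarrow>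
     (('r, 'f, 'c) tm set set \<Rightarrow> ('r, 'f, 'c) tm set) \<Rightarrow> bool" where
  "canonical_model L \<Gamma> M f \<longleftrightarrow> M = canonical_structure L \<Gamma> \<and> canonical_choice L \<Gamma> f"

definition Fm_upto :: "('r, 'f, 'c) sim_type \<Rightarrow> nat \<Rightarrow> ('r, 'f, 'c) fm set" where
  "Fm_upto L n = {\<phi>. wf_fm L \<phi> \<and> fv_fm \<phi> \<subseteq> {1..n}}"

definition satisfied_by ::
    "('r, 'f, 'c, 'm) struct \<Rightarrow> ('m set \<Rightarrow> 'm) \<Rightarrow> ('r, 'f, 'c) fm \<Rightarrow> 'm list \<Rightarrow> bool" where
  "satisfied_by M f \<theta> ms \<longleftrightarrow>
     (\<forall>a. range a \<subseteq> univ M \<and> (\<forall>k < length ms. a (Suc k) = ms ! k) \<longrightarrow> sat M f a \<theta>)"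

definition complete_in ::
    "('r, 'f, 'c) sim_type \<Rightarrow> ('r, 'f, 'c) fm set \<Rightarrow> nat \<Rightarrow> ('r, 'f, 'c) fm \<Rightarrow> bool" where
  "complete_in L T n \<theta> \<longleftrightarrow>
     (\<forall>\<phi> \<in> Fm_upto L n.
        (L, T \<turnstile> Imp \<theta> \<phi> \<or> L, T \<turnstile> Imp \<theta> (Neg \<phi>)) \<and>
        \<not> (L, T \<turnstile> Imp \<theta> \<phi> \<and> L, T \<turnstile> Imp \<theta> (Neg \<phi>)))"

definition atomic ::
    "('r, 'f, 'c) sim_type \<Rightarrow> ('r, 'f, 'c, 'm) struct \<Rightarrow> ('m set \<Rightarrow> 'm) \<Rightarrow> bool" where
  "atomic L M f \<longleftrightarrow>
     choice_structure L M f \<and>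
     (\<forall>ms. set ms \<subseteq> univ M \<longrightarrow>
        (\<exists>\<theta> \<in> Fm_upto L (length ms).
           satisfied_by M f \<theta> ms \<and> complete_in L (Th L M f) (length ms) \<theta>))"

end

theory Submission
  imports Defs
begin

text \<open>
  Every element of the canonical model is the class \<open>[t]\<close> of a closed \<open>\<epsilon>\<close>-term \<open>t\<close>, and by the
  truth lemma for the canonical model (\<open>canonical_truth\<close>) the value of \<open>t\<close> in the model is \<open>[t]\<close>
  itself (\<open>eval_Eps1\<close>). Hence a tuple \<open>([t\<^sub>1], \<dots>, [t\<^sub>n])\<close> is named by closed terms, and it
  satisfies \<open>\<theta> = (t\<^sub>1 = v\<^sub>1 \<and> \<dots> \<and> t\<^sub>n = v\<^sub>n)\<close>.

  This \<open>\<theta>\<close> is complete in every complete theory \<open>T\<close> (\<open>isolating_fm_decides\<close>): replacing the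
  variables of \<open>\<phi>\<close> one by one by the terms leads to a sentence, which \<open>T\<close> decides, and the equations
  in \<open>\<theta>\<close> carry the decision back to \<open>\<phi>\<close>. The theory of a model is complete because the model
  itself decides all sentences. That \<open>\<theta>\<close> cannot imply both \<open>\<phi>\<close> and \<open>\<not>\<phi>\<close> follows from the
  soundness of the calculus, as \<open>\<theta>\<close> is satisfied.

  The truth lemma says that \<open>\<phi>\<close> holds under the assignment \<open>v\<^sub>k \<mapsto> [\<sigma> k]\<close> iff \<open>\<Gamma>\<close> proves
  \<open>\<phi>[\<sigma>]\<close>, for \<open>\<sigma>\<close> with values in the closed \<open>\<epsilon>\<close>-terms. For an \<open>\<epsilon>\<close>-term \<open>(\<epsilon> v\<^sub>i)\<phi>\<close> the
  induction hypothesis identifies the set of witnesses with the definable set on which the canonical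
  choice function is prescribed. Only closed terms are substituted there, so bound variables
  are never renamed; renaming matters in the soundness proof alone, where \<open>eval_subst\<close> handles it.
\<close>

section \<open>Substitution\<close>

lemma finite_fv:
  "finite (fv_tm t)" "finite (fv_fm \<phi>)"
  for t :: "('r, 'f, 'c) tm" and \<phi> :: "('r, 'f, 'c) fm"
  by (induction t and \<phi> rule: fv_tm_fv_fm.induct) auto

lemma fresh_for_notin:
  assumes "finite X"
  shows "fresh_for X i \<notin> X"
proof -
  have "\<exists>j. j \<notin> X" using assms ex_new_if_finite infinite_UNIV_nat by blast
  then have "(LEAST j. j \<notin> X) \<notin> X" by (rule LeastI_ex)
  then show ?thesis by (simp add: fresh_for_def)
qed

lemma subst_cong:
  fixes t :: "('r, 'f, 'c) tm" and \<phi> :: "('r, 'f, 'c) fm"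
  shows "(\<And>k. k \<in> fv_tm t \<Longrightarrow> \<sigma> k = \<tau> k) \<Longrightarrow> subst_tm \<sigma> t = subst_tm \<tau> t"
    and "(\<And>k. k \<in> fv_fm \<phi> \<Longrightarrow> \<sigma> k = \<tau> k) \<Longrightarrow> subst_fm \<sigma> \<phi> = subst_fm \<tau> \<phi>"
proof (induction t and \<phi> arbitrary: \<sigma> \<tau> and \<sigma> \<tau> rule: fv_tm_fv_fm.induct)
  case (4 i \<phi>)
  define j where "j = fresh_for (\<Union>k \<in> fv_fm \<phi> - {i}. fv_tm (\<tau> k)) i"
  have "(\<Union>k \<in> fv_fm \<phi> - {i}. fv_tm (\<sigma> k)) = (\<Union>k \<in> fv_fm \<phi> - {i}. fv_tm (\<tau> k))"
    using "4.prems" by auto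
  moreover have "subst_fm (\<sigma>(i := Var j)) \<phi> = subst_fm (\<tau>(i := Var j)) \<phi>"
    by (rule "4.IH") (use "4.prems" in auto)
  ultimately show ?case by (simp add: j_def Let_def)
next
  case (3 g ts)
  have "subst_tm \<sigma> t = subst_tm \<tau> t" if "t \<in> set ts" for t
    by (rule "3.IH"[OF that]) (use "3.prems" that in auto)
  then show ?case by simp
next
  case (5 r ts)
  have "subst_tm \<sigma> t = subst_tm \<tau> t" if "t \<in> set ts" for t
    by (rule "5.IH"[OF that]) (use "5.prems" that in auto)
  then show ?case by simp
next
  case (6 s t)
  have "subst_tm \<sigma> s = subst_tm \<tau> s" "subst_tm \<sigma> t = subst_tm \<tau> t"
    by (rule "6.IH"; use "6.prems" in auto)+
  then show ?case by simp
next
  case (7 \<phi>)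
  have "subst_fm \<sigma> \<phi> = subst_fm \<tau> \<phi>"
    by (rule "7.IH") (use "7.prems" in auto)
  then show ?case by simp
next
  case (8 \<phi> \<psi>)
  have "subst_fm \<sigma> \<phi> = subst_fm \<tau> \<phi>" "subst_fm \<sigma> \<psi> = subst_fm \<tau> \<psi>"
    by (rule "8.IH"; use "8.prems" in auto)+
  then show ?case by simp
qed simp_all

text \<open>
  Substitutions that send each variable to a closed term or to a term in that variable alone
  never force a bound variable to be renamed.
\<close>

definition captureless :: "(nat \<Rightarrow> ('r, 'f, 'c) tm) \<Rightarrow> bool" where
  "captureless \<sigma> \<longleftrightarrow> (\<forall>k. fv_tm (\<sigma> k) \<subseteq> {k})"

lemma captureless_upd: "captureless \<sigma> \<Longrightarrow> fv_tm t \<subseteq> {i} \<Longrightarrow> captureless (\<sigma>(i := t))"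
  by (simp add: captureless_def)

lemma captureless_Var: "captureless Var"
  by (simp add: captureless_def)

lemma subst_Eps_captureless:
  assumes "captureless \<sigma>"
  shows "subst_tm \<sigma> (Eps i \<phi>) = Eps i (subst_fm (\<sigma>(i := Var i)) \<phi>)"
proof -
  have "i \<notin> (\<Union>k \<in> fv_fm \<phi> - {i}. fv_tm (\<sigma> k))"
    using assms by (fastforce simp: captureless_def)
  then have "fresh_for (\<Union>k \<in> fv_fm \<phi> - {i}. fv_tm (\<sigma> k)) i = i"
    by (simp only: fresh_for_def not_False_eq_True if_True)
  then show ?thesis by (simp only: subst_tm.simps Let_def)
qed

lemma subst_Var:
  fixes t :: "('r, 'f, 'c) tm" and \<phi> :: "('r, 'f, 'c) fm"
  shows "subst_tm Var t = t" and "subst_fm Var \<phi> = \<phi>"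
proof (induction t and \<phi> rule: fv_tm_fv_fm.induct)
  case (4 i \<phi>)
  then show ?case by (simp only: subst_Eps_captureless[OF captureless_Var] fun_upd_triv)
qed (auto intro: map_idI)

lemma subst_closed:
  "fv_tm t = {} \<Longrightarrow> subst_tm \<sigma> t = t"
  "fv_fm \<phi> = {} \<Longrightarrow> subst_fm \<sigma> \<phi> = \<phi>"
  using subst_cong[of _ \<sigma> Var] by (auto simp: subst_Var)

lemma fv_subst:
  fixes t :: "('r, 'f, 'c) tm" and \<phi> :: "('r, 'f, 'c) fm"
  shows "fv_tm (subst_tm \<sigma> t) \<subseteq> (\<Union>k \<in> fv_tm t. fv_tm (\<sigma> k))"
    and "fv_fm (subst_fm \<sigma> \<phi>) \<subseteq> (\<Union>k \<in> fv_fm \<phi>. fv_tm (\<sigma> k))"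
proof (induction t and \<phi> arbitrary: \<sigma> and \<sigma> rule: fv_tm_fv_fm.induct)
  case (4 i \<phi>)
  define j where "j = fresh_for (\<Union>k \<in> fv_fm \<phi> - {i}. fv_tm (\<sigma> k)) i"
  have "fv_fm (subst_fm (\<sigma>(i := Var j)) \<phi>) \<subseteq> (\<Union>k \<in> fv_fm \<phi>. fv_tm ((\<sigma>(i := Var j)) k))"
    by (rule "4.IH")
  also have "\<dots> \<subseteq> insert j (\<Union>k \<in> fv_fm \<phi> - {i}. fv_tm (\<sigma> k))"
    by (auto split: if_splits)
  finally have "fv_fm (subst_fm (\<sigma>(i := Var j)) \<phi>) - {j} \<subseteq> (\<Union>k \<in> fv_fm \<phi> - {i}. fv_tm (\<sigma> k))"
    by blast
  moreover have "subst_tm \<sigma> (Eps i \<phi>) = Eps j (subst_fm (\<sigma>(i := Var j)) \<phi>)"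
    by (simp only: subst_tm.simps j_def Let_def)
  ultimately show ?case by simp
next
  case (3 g ts)
  have "fv_tm (subst_tm \<sigma> t) \<subseteq> (\<Union>k \<in> fv_tm t. fv_tm (\<sigma> k))" if "t \<in> set ts" for t
    by (rule "3.IH"[OF that])
  then show ?case by simp blast
next
  case (5 r ts)
  have "fv_tm (subst_tm \<sigma> t) \<subseteq> (\<Union>k \<in> fv_tm t. fv_tm (\<sigma> k))" if "t \<in> set ts" for t
    by (rule "5.IH"[OF that])
  then show ?case by simp blast
next
  case (6 s t)
  from "6.IH"(1)[of \<sigma>] "6.IH"(2)[of \<sigma>] show ?case by (simp add: UN_Un le_supI1 le_supI2)
next
  case (8 \<phi> \<psi>)
  from "8.IH"(1)[of \<sigma>] "8.IH"(2)[of \<sigma>] show ?case by (simp add: UN_Un le_supI1 le_supI2)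
qed simp_all

lemma wf_subst:
  fixes t :: "('r, 'f, 'c) tm" and \<phi> :: "('r, 'f, 'c) fm"
  shows "wf_tm L t \<Longrightarrow> (\<And>k. wf_tm L (\<sigma> k)) \<Longrightarrow> wf_tm L (subst_tm \<sigma> t)"
    and "wf_fm L \<phi> \<Longrightarrow> (\<And>k. wf_tm L (\<sigma> k)) \<Longrightarrow> wf_fm L (subst_fm \<sigma> \<phi>)"
  by (induction t and \<phi> arbitrary: \<sigma> and \<sigma> rule: fv_tm_fv_fm.induct) (auto simp: Let_def)

lemma wf_inst: "wf_fm L \<phi> \<Longrightarrow> wf_tm L t \<Longrightarrow> wf_fm L (\<phi>[t/v i])"
  by (rule wf_subst) auto

lemma subst_subst:
  fixes t :: "('r, 'f, 'c) tm" and \<phi> :: "('r, 'f, 'c) fm"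
  shows "captureless \<sigma> \<Longrightarrow> captureless \<tau> \<Longrightarrow>
      subst_tm \<tau> (subst_tm \<sigma> t) = subst_tm (\<lambda>k. subst_tm \<tau> (\<sigma> k)) t"
    and "captureless \<sigma> \<Longrightarrow> captureless \<tau> \<Longrightarrow>
      subst_fm \<tau> (subst_fm \<sigma> \<phi>) = subst_fm (\<lambda>k. subst_tm \<tau> (\<sigma> k)) \<phi>"
proof (induction t and \<phi> arbitrary: \<sigma> \<tau> and \<sigma> \<tau> rule: fv_tm_fv_fm.induct)
  case (4 i \<phi>)
  have upd: "captureless (\<sigma>(i := Var i))" "captureless (\<tau>(i := Var i))"
    using "4.prems" by (simp_all add: captureless_upd)
  have comp: "captureless (\<lambda>k. subst_tm \<tau> (\<sigma> k))"
    unfolding captureless_def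
  proof
    fix k
    show "fv_tm (subst_tm \<tau> (\<sigma> k)) \<subseteq> {k}"
      using fv_subst(1)[of \<tau> "\<sigma> k"] "4.prems" unfolding captureless_def by blast
  qed
  have eq: "(\<lambda>k. subst_tm (\<tau>(i := Var i)) ((\<sigma>(i := Var i)) k)) =
      (\<lambda>k. subst_tm \<tau> (\<sigma> k))(i := Var i)"
  proof
    fix k
    have "subst_tm (\<tau>(i := Var i)) (\<sigma> k) = subst_tm \<tau> (\<sigma> k)" if "k \<noteq> i"
      by (rule subst_cong) (use "4.prems"(1) that in \<open>auto simp: captureless_def\<close>)
    then show "subst_tm (\<tau>(i := Var i)) ((\<sigma>(i := Var i)) k) =
        ((\<lambda>k. subst_tm \<tau> (\<sigma> k))(i := Var i)) k"
      by simp
  qed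
  show ?case
    by (simp only: subst_Eps_captureless "4.prems" comp upd "4.IH"[OF upd] eq)
qed auto

section \<open>Soundness\<close>

lemma eval_cong:
  fixes t :: "('r, 'f, 'c) tm" and \<phi> :: "('r, 'f, 'c) fm"
  shows "(\<And>k. k \<in> fv_tm t \<Longrightarrow> a k = b k) \<Longrightarrow> eval M f a t = eval M f b t"
    and "(\<And>k. k \<in> fv_fm \<phi> \<Longrightarrow> a k = b k) \<Longrightarrow> sat M f a \<phi> \<longleftrightarrow> sat M f b \<phi>"
proof (induction t and \<phi> arbitrary: a b and a b rule: fv_tm_fv_fm.induct)
  case (3 g ts)
  have "eval M f a t = eval M f b t" if "t \<in> set ts" for t
    by (rule "3.IH"[OF that]) (use "3.prems" that in auto)
  then have "map (eval M f a) ts = map (eval M f b) ts" by simp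
  then show ?case by (simp only: eval.simps)
next
  case (4 i \<phi>)
  have "sat M f (a(i := m)) \<phi> \<longleftrightarrow> sat M f (b(i := m)) \<phi>" for m
    by (rule "4.IH") (use "4.prems" in auto)
  then show ?case by simp
next
  case (5 r ts)
  have "eval M f a t = eval M f b t" if "t \<in> set ts" for t
    by (rule "5.IH"[OF that]) (use "5.prems" that in auto)
  then have "map (eval M f a) ts = map (eval M f b) ts" by simp
  then show ?case by (simp only: sat.simps)
next
  case (6 s t)
  have "eval M f a s = eval M f b s" "eval M f a t = eval M f b t"
    by (rule "6.IH"; use "6.prems" in auto)+
  then show ?case by simp
next
  case (7 \<phi>)
  have "sat M f a \<phi> = sat M f b \<phi>"
    by (rule "7.IH") (use "7.prems" in auto)
  then show ?case by simp
next
  case (8 \<phi> \<psi>)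
  have "sat M f a \<phi> = sat M f b \<phi>" "sat M f a \<psi> = sat M f b \<psi>"
    by (rule "8.IH"; use "8.prems" in auto)+
  then show ?case by simp
qed simp_all

lemma eval_subst:
  fixes t :: "('r, 'f, 'c) tm" and \<phi> :: "('r, 'f, 'c) fm"
  shows "eval M f a (subst_tm \<sigma> t) = eval M f (\<lambda>k. eval M f a (\<sigma> k)) t"
    and "sat M f a (subst_fm \<sigma> \<phi>) \<longleftrightarrow> sat M f (\<lambda>k. eval M f a (\<sigma> k)) \<phi>"
proof (induction t and \<phi> arbitrary: a \<sigma> and a \<sigma> rule: fv_tm_fv_fm.induct)
  case (3 g ts)
  then have "map (eval M f a) (map (subst_tm \<sigma>) ts) =
      map (eval M f (\<lambda>k. eval M f a (\<sigma> k))) ts" by auto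
  then show ?case by (simp only: eval.simps subst_tm.simps)
next
  case (4 i \<phi>)
  define j where "j = fresh_for (\<Union>k \<in> fv_fm \<phi> - {i}. fv_tm (\<sigma> k)) i"
  have fresh: "j \<notin> (\<Union>k \<in> fv_fm \<phi> - {i}. fv_tm (\<sigma> k))"
    unfolding j_def by (rule fresh_for_notin) (simp add: finite_fv)
  \<comment> \<open>Changing the value of \<open>v\<^sub>j\<close> does not affect the substituted terms, so renaming \<open>v\<^sub>i\<close> to \<open>v\<^sub>j\<close> is harmless.\<close>
  have "sat M f (a(j := m)) (subst_fm (\<sigma>(i := Var j)) \<phi>) \<longleftrightarrow>
      sat M f ((\<lambda>k. eval M f a (\<sigma> k))(i := m)) \<phi>" for m
  proof -
    have "sat M f (a(j := m)) (subst_fm (\<sigma>(i := Var j)) \<phi>) \<longleftrightarrow>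
        sat M f (\<lambda>k. eval M f (a(j := m)) ((\<sigma>(i := Var j)) k)) \<phi>"
      by (rule "4.IH")
    also have "\<dots> \<longleftrightarrow> sat M f ((\<lambda>k. eval M f a (\<sigma> k))(i := m)) \<phi>"
    proof (rule eval_cong)
      fix k assume "k \<in> fv_fm \<phi>"
      then have "k \<noteq> i \<Longrightarrow> eval M f (a(j := m)) (\<sigma> k) = eval M f a (\<sigma> k)"
        using fresh by (intro eval_cong) auto
      then show "eval M f (a(j := m)) ((\<sigma>(i := Var j)) k) =
          ((\<lambda>k. eval M f a (\<sigma> k))(i := m)) k"
        by auto
    qed
    finally show ?thesis .
  qed
  then show ?case by (simp add: j_def[symmetric] Let_def)
next
  case (5 r ts)
  then have "map (eval M f a) (map (subst_tm \<sigma>) ts) =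
      map (eval M f (\<lambda>k. eval M f a (\<sigma> k))) ts" by auto
  then show ?case by (simp only: sat.simps subst_fm.simps)
qed auto

lemma sat_inst: "sat M f a (\<phi>[t/v i]) \<longleftrightarrow> sat M f (a(i := eval M f a t)) \<phi>"
  unfolding eval_subst by (rule eval_cong) auto

lemma eval_in_univ:
  fixes t :: "('r, 'f, 'c) tm"
  assumes "choice_structure L M f" "range a \<subseteq> univ M" "wf_tm L t"
  shows "eval M f a t \<in> univ M"
  using assms(3)
proof (induction t rule: tm.induct[where ?P2.0 = "\<lambda>_. True"])
  case (Fun g ts)
  then have "set (map (eval M f a) ts) \<subseteq> univ M" by auto
  with Fun.prems assms(1) show ?case
    by (simp add: choice_structure_def structure_for_def)
next
  case (Eps i \<phi>)
  then show ?case using assms(1) by (simp add: choice_structure_def choice_function_def)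
qed (use assms(1,2) in \<open>auto simp: choice_structure_def structure_for_def\<close>)

lemma choice_in:
  assumes "choice_structure L M f" "S \<subseteq> univ M" "S \<noteq> {}"
  shows "f S \<in> S"
  using assms by (simp add: choice_structure_def choice_function_def)

theorem soundness:
  assumes "L, \<Gamma> \<turnstile> \<phi>" "choice_structure L M f" "range a \<subseteq> univ M"
    and hyps: "\<And>\<psi>. \<psi> \<in> \<Gamma> \<Longrightarrow> sat M f a \<psi>"
  shows "sat M f a \<phi>"
  using assms(1)
proof induction
  case (taut \<phi>)
  then show ?case unfolding tautology_def by (auto dest: spec[of _ "sat M f a"])
next
  case (eq_subst s t \<phi> i)
  show ?case by (cases "eval M f a s = eval M f a t") (simp_all add: sat_inst)
next
  case (transfinity t \<phi> i)
  define S where "S = {m \<in> univ M. sat M f (a(i := m)) \<phi>}"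
  have "eval M f a t \<in> univ M" using assms(2,3) transfinity(1) by (rule eval_in_univ)
  moreover have "S \<noteq> {} \<Longrightarrow> f S \<in> S"
    unfolding S_def by (rule choice_in[OF assms(2)]) blast
  ultimately show ?case by (auto simp: sat_inst S_def)
next
  case (extensionality \<phi> \<psi> i)
  define S where "S = {m \<in> univ M. \<not> sat M f (a(i := m)) (Iff \<phi> \<psi>)}"
  have "S \<noteq> {} \<Longrightarrow> f S \<in> S"
    unfolding S_def by (rule choice_in[OF assms(2)]) blast
  then have "sat M f a (All i (Iff \<phi> \<psi>)) \<Longrightarrow> S = {}"
    by (auto simp: All_def sat_inst S_def simp del: subst_fm.simps)
  then have "sat M f a (All i (Iff \<phi> \<psi>)) \<Longrightarrow>
      {m \<in> univ M. sat M f (a(i := m)) \<phi>} = {m \<in> univ M. sat M f (a(i := m)) \<psi>}"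
    by (auto simp: S_def)
  then show ?case by auto
qed (use hyps in auto)

section \<open>Derivations\<close>

lemma proves_wf: "L, \<Gamma> \<turnstile> \<phi> \<Longrightarrow> wf_fm L \<phi>"
  by (induction rule: proves.induct) (auto simp: wf_inst All_def)

lemma proves_taut1: "L, \<Gamma> \<turnstile> \<phi> \<Longrightarrow> wf_fm L \<psi> \<Longrightarrow> tautology (Imp \<phi> \<psi>) \<Longrightarrow> L, \<Gamma> \<turnstile> \<psi>"
  using proves.mp proves.taut proves_wf by (metis wf_fm.simps(3,4))

lemma proves_taut2:
  "L, \<Gamma> \<turnstile> \<phi> \<Longrightarrow> L, \<Gamma> \<turnstile> \<chi> \<Longrightarrow> wf_fm L \<psi> \<Longrightarrow> tautology (Imp \<phi> (Imp \<chi> \<psi>)) \<Longrightarrow> L, \<Gamma> \<turnstile> \<psi>"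
  using proves_taut1[of L \<Gamma> \<phi> "Imp \<chi> \<psi>"] proves.mp proves_wf by fastforce

lemma replace_equal:
  "L, \<Gamma> \<turnstile> Eq s t \<Longrightarrow> L, \<Gamma> \<turnstile> \<phi>[s/v i] \<Longrightarrow> wf_fm L \<phi> \<Longrightarrow> L, \<Gamma> \<turnstile> \<phi>[t/v i]"
  using proves_wf[of L \<Gamma> "Eq s t"] proves.eq_subst[of L s t \<phi> \<Gamma> i]
  by (auto dest: proves.mp)

text \<open>The well-formed closed terms, whether or not they are \<open>\<epsilon>\<close>-terms.\<close>

definition closed_tms :: "('r, 'f, 'c) sim_type \<Rightarrow> ('r, 'f, 'c) tm set" where
  "closed_tms L = {t. wf_tm L t \<and> fv_tm t = {}}"

lemma closed_tmsD: "t \<in> closed_tms L \<Longrightarrow> wf_tm L t" "t \<in> closed_tms L \<Longrightarrow> fv_tm t = {}"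
  by (auto simp: closed_tms_def)

lemma Fun_closed:
  "funs L g = Some (length ts) \<Longrightarrow> set ts \<subseteq> closed_tms L \<Longrightarrow> Fun g ts \<in> closed_tms L"
  by (auto simp: closed_tms_def)

lemma eq_sym:
  assumes "s \<in> closed_tms L" "L, \<Gamma> \<turnstile> Eq s t"
  shows "L, \<Gamma> \<turnstile> Eq t s"
  using replace_equal[OF assms(2), where \<phi> = "Eq (Var 0) s" and i = 0] assms(1)
  by (simp add: subst_closed proves.eq_refl closed_tms_def)

lemma eq_trans:
  assumes "r \<in> closed_tms L" "L, \<Gamma> \<turnstile> Eq r s" "L, \<Gamma> \<turnstile> Eq s t"
  shows "L, \<Gamma> \<turnstile> Eq r t"
  using replace_equal[OF assms(3), where \<phi> = "Eq r (Var 0)" and i = 0] assms(1,2)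
  by (simp add: subst_closed closed_tms_def)

text \<open>
  Replacement of equals in an argument list. \<open>C\<close> is any formula scheme that substitutions reach
  through its arguments only, such as \<open>Rel r\<close> or \<open>\<lambda>ts. Eq u (Fun g ts)\<close> with \<open>u\<close> closed;
  \<open>cs\<close> are the arguments already dealt with.
\<close>

lemma replace_equals:
  assumes "list_all2 (\<lambda>s t. L, \<Gamma> \<turnstile> Eq s t) as bs"
    and "set cs \<subseteq> closed_tms L" "set as \<subseteq> closed_tms L" "set bs \<subseteq> closed_tms L"
    and subst: "\<And>\<sigma> ts. subst_fm \<sigma> (C ts) = C (map (subst_tm \<sigma>) ts)"
    and wf: "\<And>ts. length ts = length (cs @ as) \<Longrightarrow> \<forall>t \<in> set ts. wf_tm L t \<Longrightarrow> wf_fm L (C ts)"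
    and "L, \<Gamma> \<turnstile> C (cs @ as)"
  shows "L, \<Gamma> \<turnstile> C (cs @ bs)"
  using assms(1-4) assms(6,7)
proof (induction as bs arbitrary: cs rule: list_all2_induct)
  case (Cons a as b bs)
  \<comment> \<open>All other arguments are closed, so \<open>v\<^sub>0\<close> marks the place of \<open>a\<close> unambiguously.\<close>
  define \<phi> where "\<phi> = C (cs @ Var 0 # as)"
  have map_closed: "map (subst_tm \<sigma>) ts = ts" if "set ts \<subseteq> closed_tms L" for \<sigma> ts
    using that by (intro map_idI) (auto simp: closed_tms_def subst_closed)
  have inst: "\<phi>[t/v 0] = C (cs @ t # as)" for t
    using Cons.prems by (simp add: \<phi>_def subst map_closed)
  have "wf_fm L \<phi>"
    unfolding \<phi>_def by (rule Cons.prems) (use Cons.prems in \<open>auto simp: closed_tms_def\<close>)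
  then have "L, \<Gamma> \<turnstile> C (cs @ b # as)"
    using replace_equal[OF Cons.hyps(1), where \<phi> = \<phi> and i = 0] Cons.prems(5) by (simp only: inst)
  then show ?case
    using Cons.IH[of "cs @ [b]"] Cons.prems by simp
qed simp

section \<open>The canonical model\<close>

lemma Eps1_closed: "Eps1 L \<subseteq> closed_tms L"
  by (auto simp: Eps1_def Fm_def closed_tms_def)

lemma set_Eps1_closed: "set ts \<subseteq> Eps1 L \<Longrightarrow> set ts \<subseteq> closed_tms L"
  using Eps1_closed by (rule subset_trans[rotated])

lemma equiv_eq_mod: "equiv (Eps1 L) (eq_mod L \<Gamma>)"
proof (rule equivI)
  show "eq_mod L \<Gamma> \<subseteq> Eps1 L \<times> Eps1 L" by (auto simp: eq_mod_def)
  show "refl_on (Eps1 L) (eq_mod L \<Gamma>)"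
    using Eps1_closed by (auto simp: refl_on_def eq_mod_def closed_tms_def intro: proves.eq_refl)
  show "sym (eq_mod L \<Gamma>)"
    using Eps1_closed by (auto simp: sym_def eq_mod_def intro: eq_sym)
  show "trans (eq_mod L \<Gamma>)"
    using Eps1_closed by (auto simp: trans_def eq_mod_def intro: eq_trans)
qed

lemma cls_eq_iff:
  "s \<in> Eps1 L \<Longrightarrow> t \<in> Eps1 L \<Longrightarrow> cls L \<Gamma> s = cls L \<Gamma> t \<longleftrightarrow> L, \<Gamma> \<turnstile> Eq s t"
  unfolding cls_def by (simp add: eq_equiv_class_iff[OF equiv_eq_mod]) (simp add: eq_mod_def)

lemma univ_canonical: "univ (canonical_structure L \<Gamma>) = cls L \<Gamma> ` Eps1 L"
  by (auto simp: canonical_structure_def quotient_def cls_def)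

lemma canonical_tuple:
  assumes "set ms \<subseteq> univ (canonical_structure L \<Gamma>)"
  obtains ts where "set ts \<subseteq> Eps1 L" "ms = map (cls L \<Gamma>) ts"
proof -
  have "ms \<in> lists (cls L \<Gamma> ` Eps1 L)"
    using assms by (simp only: univ_canonical in_lists_conv_set subset_iff) blast
  then have "ms \<in> map (cls L \<Gamma>) ` lists (Eps1 L)" by (simp only: lists_image)
  then obtain ts where "ts \<in> lists (Eps1 L)" "ms = map (cls L \<Gamma>) ts" by blast
  then show ?thesis using that[of ts] by (simp add: in_lists_conv_set subset_iff)
qed

text \<open>
  The canonical \<open>\<epsilon>\<close>-term provably equal to a closed term \<open>t\<close>. The universe consists of classes of
  \<open>\<epsilon>\<close>-terms only, so this term represents the value of \<open>t\<close>.
\<close>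

definition eps_of :: "('r, 'f, 'c) tm \<Rightarrow> ('r, 'f, 'c) tm" where
  "eps_of t = Eps 0 (Eq (Var 0) t)"

lemma eps_of_Eps1: "t \<in> closed_tms L \<Longrightarrow> eps_of t \<in> Eps1 L"
  by (auto simp: eps_of_def Eps1_def Fm_def closed_tms_def)

text \<open>This is transfinity for \<open>v\<^sub>0 = t\<close>, witnessed by \<open>t\<close>.\<close>

lemma eps_of_eq:
  assumes "t \<in> closed_tms L"
  shows "L, \<Gamma> \<turnstile> Eq (eps_of t) t"
proof -
  have "L, \<Gamma> \<turnstile> Imp (Eq t t) (Eq (eps_of t) t)"
    using proves.transfinity[of L t "Eq (Var 0) t" \<Gamma> 0] assms
    by (simp add: closed_tms_def subst_closed eps_of_def)
  then show ?thesis using proves.mp proves.eq_refl assms closed_tmsD by blast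
qed

lemma cls_eps_of_eq_iff:
  assumes "s \<in> closed_tms L" "t \<in> closed_tms L"
  shows "cls L \<Gamma> (eps_of s) = cls L \<Gamma> (eps_of t) \<longleftrightarrow> L, \<Gamma> \<turnstile> Eq s t"
proof -
  have "eps_of s \<in> closed_tms L" "eps_of t \<in> closed_tms L"
    using assms eps_of_Eps1 Eps1_closed by blast+
  then have "L, \<Gamma> \<turnstile> Eq (eps_of s) (eps_of t) \<longleftrightarrow> L, \<Gamma> \<turnstile> Eq s t"
    by (meson assms eps_of_eq eq_sym eq_trans)
  with assms show ?thesis by (simp add: cls_eq_iff eps_of_Eps1)
qed

lemma cls_eps_of:
  assumes "t \<in> Eps1 L"
  shows "cls L \<Gamma> (eps_of t) = cls L \<Gamma> t"
proof -
  have "t \<in> closed_tms L" using assms Eps1_closed by (rule subsetD[rotated])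
  then show ?thesis using assms by (simp add: cls_eq_iff eps_of_Eps1 eps_of_eq)
qed

lemma map_cls_eq:
  assumes "map (cls L \<Gamma>) as = map (cls L \<Gamma>) bs" "set as \<subseteq> Eps1 L" "set bs \<subseteq> Eps1 L"
  shows "list_all2 (\<lambda>s t. L, \<Gamma> \<turnstile> Eq s t) as bs"
  unfolding list_all2_conv_all_nth
proof (intro conjI allI impI)
  show len: "length as = length bs" using assms(1) by (rule map_eq_imp_length_eq)
  fix k assume k: "k < length as"
  then have "as ! k \<in> Eps1 L" "bs ! k \<in> Eps1 L" using assms(2,3) len by auto
  moreover have "cls L \<Gamma> (as ! k) = cls L \<Gamma> (bs ! k)"
    using arg_cong[OF assms(1), of "\<lambda>xs. xs ! k"] k len by simp
  ultimately show "L, \<Gamma> \<turnstile> Eq (as ! k) (bs ! k)" by (simp add: cls_eq_iff)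
qed

lemma proves_Eq_Fun:
  assumes "list_all2 (\<lambda>s t. L, \<Gamma> \<turnstile> Eq s t) as bs" "set as \<subseteq> closed_tms L" "set bs \<subseteq> closed_tms L"
    and "funs L g = Some (length as)"
  shows "L, \<Gamma> \<turnstile> Eq (Fun g as) (Fun g bs)"
proof -
  have closed: "Fun g as \<in> closed_tms L"
    using assms by (auto simp: closed_tms_def)
  have "L, \<Gamma> \<turnstile> Eq (Fun g as) (Fun g ([] @ bs))"
  proof (rule replace_equals[where C = "\<lambda>ts. Eq (Fun g as) (Fun g ts)"])
    show "subst_fm \<sigma> (Eq (Fun g as) (Fun g ts)) = Eq (Fun g as) (Fun g (map (subst_tm \<sigma>) ts))" for \<sigma> ts
      using closed subst_closed(1)[of "Fun g as" \<sigma>] by (simp add: closed_tms_def)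
    show "L, \<Gamma> \<turnstile> Eq (Fun g as) (Fun g ([] @ as))"
      using closed by (simp add: closed_tmsD proves.eq_refl del: wf_tm.simps)
  qed (use assms closed in \<open>auto simp: closed_tms_def\<close>)
  then show ?thesis by simp
qed

lemma proves_Rel_cong:
  assumes "list_all2 (\<lambda>s t. L, \<Gamma> \<turnstile> Eq s t) as bs" "set as \<subseteq> closed_tms L" "set bs \<subseteq> closed_tms L"
    and "L, \<Gamma> \<turnstile> Rel r as"
  shows "L, \<Gamma> \<turnstile> Rel r bs"
  using replace_equals[OF assms(1), of "[]" "Rel r"] assms(2-4) proves_wf[OF assms(4)] by simp

text \<open>
  The description that defines the function symbols of the canonical model is proper: it does not
  depend on the representatives.
\<close>

lemma fun_of_canonical:
  assumes "set as \<subseteq> Eps1 L" "funs L g = Some (length as)"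
  shows "fun_of (canonical_structure L \<Gamma>) g (map (cls L \<Gamma>) as) = cls L \<Gamma> (eps_of (Fun g as))"
proof -
  have "cls L \<Gamma> (eps_of (Fun g bs)) = cls L \<Gamma> (eps_of (Fun g as))"
    if "set bs \<subseteq> Eps1 L" "map (cls L \<Gamma>) as = map (cls L \<Gamma>) bs" for bs
  proof -
    have "length as = length bs" using that(2) by (rule map_eq_imp_length_eq)
    moreover have "list_all2 (\<lambda>s t. L, \<Gamma> \<turnstile> Eq s t) bs as"
      using that assms(1) by (intro map_cls_eq) simp_all
    ultimately have "L, \<Gamma> \<turnstile> Eq (Fun g bs) (Fun g as)"
      using assms that(1) by (intro proves_Eq_Fun set_Eps1_closed) simp_all
    moreover have "Fun g as \<in> closed_tms L" "Fun g bs \<in> closed_tms L"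
      using assms that(1) \<open>length as = length bs\<close> by (intro Fun_closed set_Eps1_closed; simp)+
    ultimately show ?thesis by (simp add: cls_eps_of_eq_iff)
  qed
  with assms(1) show ?thesis
    unfolding canonical_structure_def eps_of_def struct.simps by (intro the_equality) blast+
qed

lemma structure_for_canonical: "structure_for L (canonical_structure L \<Gamma>)"
  unfolding structure_for_def
proof (intro conjI allI impI ballI)
  have "Eps 0 (Eq (Var 0) (Var 0)) \<in> Eps1 L" by (auto simp: Eps1_def Fm_def)
  then show "univ (canonical_structure L \<Gamma>) \<noteq> {}" by (auto simp: univ_canonical)
next
  fix r n assume "rels L r = Some n"
  then show "rel_of (canonical_structure L \<Gamma>) r \<subseteq>
      {ms. set ms \<subseteq> univ (canonical_structure L \<Gamma>) \<and> length ms = n}"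
    unfolding univ_canonical by (auto simp: canonical_structure_def subset_iff dest!: proves_wf)
next
  fix g n ms
  assume *: "funs L g = Some n \<and> set ms \<subseteq> univ (canonical_structure L \<Gamma>) \<and> length ms = n"
  then obtain as where as: "set as \<subseteq> Eps1 L" "ms = map (cls L \<Gamma>) as"
    by (blast elim: canonical_tuple)
  have "Fun g as \<in> closed_tms L"
    using * as by (intro Fun_closed set_Eps1_closed) simp_all
  then show "fun_of (canonical_structure L \<Gamma>) g ms \<in> univ (canonical_structure L \<Gamma>)"
    using * as by (simp add: fun_of_canonical univ_canonical eps_of_Eps1)
next
  fix c assume "c \<in> consts_of L"
  then have "Const c \<in> closed_tms L" by (simp add: closed_tms_def)
  then show "const_of (canonical_structure L \<Gamma>) c \<in> univ (canonical_structure L \<Gamma>)"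
    using eps_of_Eps1 unfolding univ_canonical
    by (auto simp: canonical_structure_def eps_of_def)
qed

text \<open>
  The truth lemma. An open formula is evaluated by substituting representatives of the values of its
  variables. Terms need \<open>eps_of\<close>, as \<open>subst_tm \<sigma> t\<close> need not be an \<open>\<epsilon>\<close>-term.
\<close>

lemma canonical_truth:
  fixes t :: "('r, 'f, 'c) tm" and \<phi> :: "('r, 'f, 'c) fm"
  assumes "complete_theory L \<Gamma>" "consistent L \<Gamma>"
    and "canonical_model L \<Gamma> M f"
  shows "wf_tm L t \<Longrightarrow> range \<sigma> \<subseteq> Eps1 L \<Longrightarrow>
      eval M f (\<lambda>k. cls L \<Gamma> (\<sigma> k)) t = cls L \<Gamma> (eps_of (subst_tm \<sigma> t))"
    and "wf_fm L \<phi> \<Longrightarrow> range \<sigma> \<subseteq> Eps1 L \<Longrightarrow>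
      sat M f (\<lambda>k. cls L \<Gamma> (\<sigma> k)) \<phi> \<longleftrightarrow> L, \<Gamma> \<turnstile> subst_fm \<sigma> \<phi>"
proof -
  have M: "M = canonical_structure L \<Gamma>"
    and choice: "\<And>i \<phi>. \<phi> \<in> Fm L i \<Longrightarrow>
      f {cls L \<Gamma> t | t. t \<in> Eps1 L \<and> L, \<Gamma> \<turnstile> \<phi>[t/v i]} = cls L \<Gamma> (Eps i \<phi>)"
    using assms(3) by (auto simp: canonical_model_def canonical_choice_def)
  have fv\<sigma>: "fv_tm (\<sigma> k) = {}" and wf\<sigma>: "wf_tm L (\<sigma> k)" if "range \<sigma> \<subseteq> Eps1 L" for \<sigma> :: "nat \<Rightarrow> ('r, 'f, 'c) tm" and k
    using that Eps1_closed by (auto simp: closed_tms_def)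
  have closed: "subst_tm \<sigma> t \<in> closed_tms L" if "wf_tm L t" "range \<sigma> \<subseteq> Eps1 L" for \<sigma> t
    using fv_subst(1)[of \<sigma> t] fv\<sigma>[OF that(2)] wf_subst(1)[OF that(1) wf\<sigma>[OF that(2)]]
    by (simp add: closed_tms_def)
  have sent: "subst_fm \<sigma> \<phi> \<in> Sent L" if "wf_fm L \<phi>" "range \<sigma> \<subseteq> Eps1 L" for \<sigma> \<phi>
    using fv_subst(2)[of \<sigma> \<phi>] fv\<sigma>[OF that(2)] wf_subst(2)[OF that(1) wf\<sigma>[OF that(2)]]
    by (simp add: Sent_def)
  have neg: "L, \<Gamma> \<turnstile> Neg \<phi> \<longleftrightarrow> \<not> L, \<Gamma> \<turnstile> \<phi>" if "\<phi> \<in> Sent L" for \<phi>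
    using assms(1,2) that by (auto simp: complete_theory_def consistent_def)
  show "wf_tm L t \<Longrightarrow> range \<sigma> \<subseteq> Eps1 L \<Longrightarrow>
      eval M f (\<lambda>k. cls L \<Gamma> (\<sigma> k)) t = cls L \<Gamma> (eps_of (subst_tm \<sigma> t))"
    and "wf_fm L \<phi> \<Longrightarrow> range \<sigma> \<subseteq> Eps1 L \<Longrightarrow>
      sat M f (\<lambda>k. cls L \<Gamma> (\<sigma> k)) \<phi> \<longleftrightarrow> L, \<Gamma> \<turnstile> subst_fm \<sigma> \<phi>"
  proof (induction t and \<phi> arbitrary: \<sigma> and \<sigma> rule: fv_tm_fv_fm.induct)
    case (1 i)
    then have "\<sigma> i \<in> Eps1 L" by blast
    then show ?case by (simp add: cls_eps_of)
  next
    case (2 c)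
    then show ?case by (simp add: M canonical_structure_def eps_of_def)
  next
    case (3 g ts)
    define us where "us = map (subst_tm \<sigma>) ts"
    have us: "set us \<subseteq> closed_tms L"
      using 3 closed by (auto simp: us_def)
    then have eps: "set (map eps_of us) \<subseteq> Eps1 L" using eps_of_Eps1 by auto
    have len: "funs L g = Some (length (map eps_of us))" using 3 by (simp add: us_def)
    have "map (eval M f (\<lambda>k. cls L \<Gamma> (\<sigma> k))) ts = map (cls L \<Gamma>) (map eps_of us)"
      using 3 by (auto simp: us_def)
    then have "eval M f (\<lambda>k. cls L \<Gamma> (\<sigma> k)) (Fun g ts) =
        cls L \<Gamma> (eps_of (Fun g (map eps_of us)))"
      using fun_of_canonical[OF eps len, of \<Gamma>] by (simp only: eval.simps M)
    also have "\<dots> = cls L \<Gamma> (eps_of (Fun g us))"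
    proof (subst cls_eps_of_eq_iff)
      have "list_all2 (\<lambda>s t. L, \<Gamma> \<turnstile> Eq s t) (map eps_of us) us"
        using us by (auto simp: list_all2_conv_all_nth intro!: eps_of_eq)
      then show "L, \<Gamma> \<turnstile> Eq (Fun g (map eps_of us)) (Fun g us)"
        using set_Eps1_closed[OF eps] us len by (rule proves_Eq_Fun)
      show "Fun g (map eps_of us) \<in> closed_tms L"
        using len set_Eps1_closed[OF eps] by (rule Fun_closed)
      show "Fun g us \<in> closed_tms L"
        using len us by (intro Fun_closed) simp_all
    qed
    finally show ?case by (simp add: us_def)
  next
    case (4 i \<phi>)
    \<comment> \<open>\<open>\<psi>\<close> has no free variable but \<open>v\<^sub>i\<close>, so the choice function is prescribed on the set it defines.\<close>
    define \<psi> where "\<psi> = subst_fm (\<sigma>(i := Var i)) \<phi>"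
    have \<psi>: "\<psi> \<in> Fm L i"
    proof -
      have "fv_fm \<psi> \<subseteq> (\<Union>k \<in> fv_fm \<phi>. fv_tm ((\<sigma>(i := Var i)) k))"
        unfolding \<psi>_def by (rule fv_subst)
      also have "\<dots> \<subseteq> {i}" using fv\<sigma>[OF "4.prems"(2)] by (auto split: if_splits)
      finally have "fv_fm \<psi> \<subseteq> {i}" .
      moreover have "wf_fm L \<psi>"
        unfolding \<psi>_def using "4.prems" wf\<sigma> by (intro wf_subst) auto
      ultimately show ?thesis by (simp add: Fm_def)
    qed
    have inst: "\<psi>[t/v i] = subst_fm (\<sigma>(i := t)) \<phi>" if "t \<in> Eps1 L" for t
    proof -
      have fvt: "fv_tm t = {}" using that Eps1_closed closed_tmsD by blast
      have "\<psi>[t/v i] = subst_fm (\<lambda>k. subst_tm (Var(i := t)) ((\<sigma>(i := Var i)) k)) \<phi>"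
        unfolding \<psi>_def by (rule subst_subst) (use fvt fv\<sigma>[OF "4.prems"(2)] in \<open>auto simp: captureless_def\<close>)
      also have "(\<lambda>k. subst_tm (Var(i := t)) ((\<sigma>(i := Var i)) k)) = \<sigma>(i := t)"
        using fv\<sigma>[OF "4.prems"(2)] by (auto simp: subst_closed)
      finally show ?thesis .
    qed
    have "sat M f ((\<lambda>k. cls L \<Gamma> (\<sigma> k))(i := cls L \<Gamma> t)) \<phi> \<longleftrightarrow> L, \<Gamma> \<turnstile> \<psi>[t/v i]"
      if "t \<in> Eps1 L" for t
    proof -
      have "(\<lambda>k. cls L \<Gamma> (\<sigma> k))(i := cls L \<Gamma> t) = (\<lambda>k. cls L \<Gamma> ((\<sigma>(i := t)) k))"
        by (simp add: fun_eq_iff)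
      moreover have "wf_fm L \<phi>" "range (\<sigma>(i := t)) \<subseteq> Eps1 L" using "4.prems" that by auto
      ultimately show ?thesis using "4.IH"[of "\<sigma>(i := t)"] that by (simp only: inst)
    qed
    then have "{m \<in> univ M. sat M f ((\<lambda>k. cls L \<Gamma> (\<sigma> k))(i := m)) \<phi>} =
        {cls L \<Gamma> t | t. t \<in> Eps1 L \<and> L, \<Gamma> \<turnstile> \<psi>[t/v i]}"
      unfolding M univ_canonical by auto
    then have "eval M f (\<lambda>k. cls L \<Gamma> (\<sigma> k)) (Eps i \<phi>) = cls L \<Gamma> (Eps i \<psi>)"
      using choice[OF \<psi>] by simp
    also have "\<dots> = cls L \<Gamma> (eps_of (Eps i \<psi>))"
      using \<psi> by (intro cls_eps_of[symmetric]) (auto simp: Eps1_def)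
    also have "Eps i \<psi> = subst_tm \<sigma> (Eps i \<phi>)"
      unfolding \<psi>_def using fv\<sigma>[OF "4.prems"(2)]
      by (intro subst_Eps_captureless[symmetric]) (simp add: captureless_def)
    finally show ?case .
  next
    case (5 r ts)
    define us where "us = map (subst_tm \<sigma>) ts"
    have us: "set us \<subseteq> closed_tms L"
      using 5 closed by (auto simp: us_def)
    then have eps: "set (map eps_of us) \<subseteq> Eps1 L" using eps_of_Eps1 by auto
    then have eps': "set (map eps_of us) \<subseteq> closed_tms L" by (rule set_Eps1_closed)
    have "map (eval M f (\<lambda>k. cls L \<Gamma> (\<sigma> k))) ts = map (cls L \<Gamma>) (map eps_of us)"
      using 5 by (auto simp: us_def)
    then have "sat M f (\<lambda>k. cls L \<Gamma> (\<sigma> k)) (Rel r ts) \<longleftrightarrow>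
        (\<exists>as. map (cls L \<Gamma>) (map eps_of us) = map (cls L \<Gamma>) as \<and> set as \<subseteq> Eps1 L \<and> L, \<Gamma> \<turnstile> Rel r as)"
      by (simp only: sat.simps) (simp add: M canonical_structure_def)
    also have "\<dots> \<longleftrightarrow> L, \<Gamma> \<turnstile> Rel r (map eps_of us)"
    proof
      assume "\<exists>as. map (cls L \<Gamma>) (map eps_of us) = map (cls L \<Gamma>) as \<and> set as \<subseteq> Eps1 L \<and> L, \<Gamma> \<turnstile> Rel r as"
      then obtain as where as: "map (cls L \<Gamma>) as = map (cls L \<Gamma>) (map eps_of us)"
        "set as \<subseteq> Eps1 L" "L, \<Gamma> \<turnstile> Rel r as"
        by metis
      from map_cls_eq[OF as(1,2) eps] set_Eps1_closed[OF as(2)] eps' as(3)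
      show "L, \<Gamma> \<turnstile> Rel r (map eps_of us)" by (rule proves_Rel_cong)
    qed (use eps in blast)
    also have "\<dots> \<longleftrightarrow> L, \<Gamma> \<turnstile> Rel r us"
    proof -
      have eq: "L, \<Gamma> \<turnstile> Eq (eps_of u) u" "L, \<Gamma> \<turnstile> Eq u (eps_of u)" if "u \<in> set us" for u
      proof -
        have "u \<in> closed_tms L" "eps_of u \<in> closed_tms L" using that us eps' by auto
        then show "L, \<Gamma> \<turnstile> Eq (eps_of u) u" "L, \<Gamma> \<turnstile> Eq u (eps_of u)"
          by (simp_all add: eps_of_eq eq_sym)
      qed
      then have "list_all2 (\<lambda>s t. L, \<Gamma> \<turnstile> Eq s t) (map eps_of us) us"
        "list_all2 (\<lambda>s t. L, \<Gamma> \<turnstile> Eq s t) us (map eps_of us)"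
        by (auto simp: list_all2_conv_all_nth)
      then show ?thesis using proves_Rel_cong[OF _ us eps'] proves_Rel_cong[OF _ eps' us] by blast
    qed
    finally show ?case by (simp add: us_def)
  next
    case (6 s t)
    then show ?case using closed by (simp add: cls_eps_of_eq_iff)
  next
    case (7 \<phi>)
    then show ?case using sent neg by simp
  next
    case (8 \<phi> \<psi>)
    let ?\<phi> = "subst_fm \<sigma> \<phi>" and ?\<psi> = "subst_fm \<sigma> \<psi>"
    have wf: "wf_fm L ?\<phi>" "wf_fm L ?\<psi>" and neg\<phi>: "L, \<Gamma> \<turnstile> Neg ?\<phi> \<longleftrightarrow> \<not> L, \<Gamma> \<turnstile> ?\<phi>"
      using 8 sent neg by (auto simp: Sent_def)
    have "L, \<Gamma> \<turnstile> Or ?\<phi> ?\<psi>" if "L, \<Gamma> \<turnstile> ?\<phi>"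
      using that by (rule proves_taut1) (use wf in \<open>auto simp: tautology_def\<close>)
    moreover have "L, \<Gamma> \<turnstile> Or ?\<phi> ?\<psi>" if "L, \<Gamma> \<turnstile> ?\<psi>"
      using that by (rule proves_taut1) (use wf in \<open>auto simp: tautology_def\<close>)
    moreover have "L, \<Gamma> \<turnstile> ?\<psi>" if "L, \<Gamma> \<turnstile> Or ?\<phi> ?\<psi>" "L, \<Gamma> \<turnstile> Neg ?\<phi>"
      using that by (rule proves_taut2) (use wf in \<open>auto simp: tautology_def\<close>)
    ultimately have "L, \<Gamma> \<turnstile> Or ?\<phi> ?\<psi> \<longleftrightarrow> L, \<Gamma> \<turnstile> ?\<phi> \<or> L, \<Gamma> \<turnstile> ?\<psi>"
      using neg\<phi> by blast
    with 8 show ?case by simp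
  qed
qed

lemma eval_Eps1:
  assumes "complete_theory L \<Gamma>" "consistent L \<Gamma>" "canonical_model L \<Gamma> M f" "t \<in> Eps1 L"
  shows "eval M f a t = cls L \<Gamma> t"
proof -
  have closed: "wf_tm L t" "fv_tm t = {}"
    using assms(4) Eps1_closed closed_tmsD by blast+
  then have "eval M f a t = eval M f (\<lambda>_. cls L \<Gamma> t) t"
    by (intro eval_cong) auto
  also have "\<dots> = cls L \<Gamma> (eps_of t)"
    using canonical_truth(1)[OF assms(1-3) closed(1), of "\<lambda>_. t"] assms(4) closed(2)
    by (simp add: subst_closed)
  finally show ?thesis using assms(4) by (simp add: cls_eps_of)
qed

section \<open>Isolating formulae\<close>

text \<open>
  \<open>isolating_fm ts n\<close> is the conjunction of \<open>ts ! k = v\<^sub>k\<^sub>+\<^sub>1\<close> for \<open>k < n\<close>: positions in \<open>ts\<close> are counted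
  from \<open>0\<close>, the variables of an \<open>n\<close>-tuple from \<open>1\<close>. The empty conjunction is a closed identity.
  The terms are on the left so that \<open>eq_subst\<close> applies to the equations as they stand.
\<close>

fun isolating_fm :: "('r, 'f, 'c) tm list \<Rightarrow> nat \<Rightarrow> ('r, 'f, 'c) fm" where
  "isolating_fm ts 0 = Eq (Eps 0 (Eq (Var 0) (Var 0))) (Eps 0 (Eq (Var 0) (Var 0)))"
| "isolating_fm ts (Suc n) = And (Eq (ts ! n) (Var (Suc n))) (isolating_fm ts n)"

lemma isolating_fm_Fm_upto:
  assumes "set ts \<subseteq> closed_tms L" "n \<le> length ts"
  shows "isolating_fm ts n \<in> Fm_upto L n"
  using assms(2)
proof (induction n)
  case (Suc n)
  then have "ts ! n \<in> closed_tms L" using assms(1) by auto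
  with Suc show ?case by (auto simp: Fm_upto_def closed_tms_def)
qed (simp add: Fm_upto_def)

lemma sat_isolating_fm:
  "sat M f a (isolating_fm ts n) \<longleftrightarrow> (\<forall>k < n. eval M f a (ts ! k) = a (Suc k))"
  by (induction n) (auto simp: less_Suc_eq)

text \<open>
  By induction on \<open>n\<close>, eliminating the variable \<open>v\<^sub>n\<^sub>+\<^sub>1\<close> from \<open>\<phi>\<close> by the substitution of \<open>ts ! n\<close>.
\<close>

lemma isolating_fm_decides:
  assumes "complete_theory L T" "set ts \<subseteq> closed_tms L" "n \<le> length ts" "\<phi> \<in> Fm_upto L n"
  shows "L, T \<turnstile> Imp (isolating_fm ts n) \<phi> \<or> L, T \<turnstile> Imp (isolating_fm ts n) (Neg \<phi>)"
  using assms(3,4)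
proof (induction n arbitrary: \<phi>)
  case 0
  then have "\<phi> \<in> Sent L" and wf: "wf_fm L \<phi>" by (auto simp: Fm_upto_def Sent_def)
  then have "L, T \<turnstile> \<phi> \<or> L, T \<turnstile> Neg \<phi>" using assms(1) by (simp add: complete_theory_def)
  moreover have "L, T \<turnstile> Imp (isolating_fm ts 0) \<psi>" if "L, T \<turnstile> \<psi>" for \<psi>
    using that by (rule proves_taut1) (use proves_wf[OF that] in \<open>auto simp: tautology_def\<close>)
  ultimately show ?case by blast
next
  case (Suc n)
  let ?t = "ts ! n" and ?x = "Var (Suc n)" and ?\<theta> = "isolating_fm ts n"
  have t: "?t \<in> closed_tms L" using Suc.prems(1) assms(2) by auto
  have wf: "wf_fm L \<phi>" using Suc.prems by (simp add: Fm_upto_def)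
  have "fv_fm (\<phi>[?t/v (Suc n)]) \<subseteq> {1..n}"
  proof -
    have "fv_fm (\<phi>[?t/v (Suc n)]) \<subseteq> (\<Union>k \<in> fv_fm \<phi>. fv_tm ((Var(Suc n := ?t)) k))"
      by (rule fv_subst)
    also have "\<dots> \<subseteq> fv_fm \<phi> - {Suc n}" using t by (auto simp: closed_tms_def split: if_splits)
    also have "\<dots> \<subseteq> {1..n}" using Suc.prems(2) by (auto simp: Fm_upto_def)
    finally show ?thesis .
  qed
  then have IH: "L, T \<turnstile> Imp ?\<theta> (\<phi>[?t/v (Suc n)]) \<or> L, T \<turnstile> Imp ?\<theta> (Neg \<phi>[?t/v (Suc n)])"
    using Suc.IH[of "\<phi>[?t/v (Suc n)]"] Suc.prems(1) wf t
    by (simp add: Fm_upto_def wf_inst closed_tmsD)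
  have step: "L, T \<turnstile> Imp (isolating_fm ts (Suc n)) \<psi>"
    if "L, T \<turnstile> Imp ?\<theta> (\<psi>[?t/v (Suc n)])" "wf_fm L \<psi>" for \<psi>
  proof -
    \<comment> \<open>Instantiating \<open>eq_subst\<close> with the variable itself leads back from \<open>ts ! n\<close> to \<open>v\<^sub>n\<^sub>+\<^sub>1\<close>.\<close>
    have "\<psi>[?x/v (Suc n)] = \<psi>" by (simp add: fun_upd_idem subst_Var)
    then have "L, T \<turnstile> Imp (Eq ?t ?x) (Imp (\<psi>[?t/v (Suc n)]) \<psi>)"
      using proves.eq_subst[of L ?t ?x \<psi> T "Suc n"] t that(2) by (simp add: closed_tmsD)
    from that(1) this show ?thesis
      by (rule proves_taut2)
        (use that proves_wf[OF that(1)] t in \<open>auto simp: tautology_def closed_tmsD\<close>)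
  qed
  show ?case using IH step[of \<phi>] step[of "Neg \<phi>"] wf by auto
qed

lemma complete_Th: "complete_theory L (Th L M f)"
  unfolding complete_theory_def
proof
  fix \<phi> assume \<phi>: "\<phi> \<in> Sent L"
  then have "sat M f a \<phi> \<longleftrightarrow> sat M f b \<phi>" for a b
    by (intro eval_cong) (simp add: Sent_def)
  with \<phi> have "\<phi> \<in> Th L M f \<or> Neg \<phi> \<in> Th L M f"
    by (auto simp: Th_def Sent_def)
  with \<phi> show "L, Th L M f \<turnstile> \<phi> \<or> L, Th L M f \<turnstile> Neg \<phi>"
    by (auto intro!: proves.hyp simp: Sent_def)
qed

theorem proposition2:
  fixes L :: "('r, 'f, 'c) sim_type"
    and \<Gamma> :: "('r, 'f, 'c) fm set"
    and M :: "('r, 'f, 'c, ('r, 'f, 'c) tm set) struct"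
    and f :: "('r, 'f, 'c) tm set set \<Rightarrow> ('r, 'f, 'c) tm set"
  assumes "\<Gamma> \<subseteq> Sent L"
    and "complete_theory L \<Gamma>"
    and "consistent L \<Gamma>"
    and "canonical_model L \<Gamma> M f"
  shows "atomic L M f"
  unfolding atomic_def
proof (intro conjI allI impI)
  show model: "choice_structure L M f"
    using assms(4) structure_for_canonical
    by (auto simp: choice_structure_def canonical_model_def canonical_choice_def)
  fix ms assume ms: "set ms \<subseteq> univ M"
  then obtain ts where ts: "set ts \<subseteq> Eps1 L" "ms = map (cls L \<Gamma>) ts"
    using assms(4) by (auto simp: canonical_model_def elim: canonical_tuple)
  then have closed: "set ts \<subseteq> closed_tms L" using Eps1_closed by blast
  have len: "length ms = length ts" using ts by simp
  let ?n = "length ms"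
  let ?\<theta> = "isolating_fm ts ?n"
  have \<theta>: "?\<theta> \<in> Fm_upto L ?n" using closed len by (intro isolating_fm_Fm_upto) simp_all
  have sat: "satisfied_by M f ?\<theta> ms"
    unfolding satisfied_by_def sat_isolating_fm
  proof (intro allI impI)
    fix a k assume "range a \<subseteq> univ M \<and> (\<forall>k < ?n. a (Suc k) = ms ! k)" "k < ?n"
    moreover from this have "ts ! k \<in> Eps1 L" using ts(1) len by auto
    ultimately show "eval M f a (ts ! k) = a (Suc k)"
      using eval_Eps1[OF assms(2-4)] ts(2) by simp
  qed
  obtain m where m: "m \<in> univ M"
    using model by (auto simp: choice_structure_def structure_for_def)
  \<comment> \<open>An assignment of the tuple; off \<open>{1..?n}\<close> any value in the universe will do.\<close>
  define a where "a k = (if k \<in> {1..?n} then ms ! (k - 1) else m)" for k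
  have a: "range a \<subseteq> univ M" using m ms by (auto simp: a_def dest!: nth_mem[of "_ - 1" ms])
  then have sat_a: "sat M f a ?\<theta>" using sat by (auto simp: satisfied_by_def a_def)
  have sound: "sat M f a \<psi>" if "L, Th L M f \<turnstile> \<psi>" for \<psi>
    using that model a by (rule soundness) (use a in \<open>auto simp: Th_def\<close>)
  have "\<not> (L, Th L M f \<turnstile> Imp ?\<theta> \<phi> \<and> L, Th L M f \<turnstile> Imp ?\<theta> (Neg \<phi>))" for \<phi>
    using sat_a sound[of "Imp ?\<theta> \<phi>"] sound[of "Imp ?\<theta> (Neg \<phi>)"] by auto
  moreover have "L, Th L M f \<turnstile> Imp ?\<theta> \<phi> \<or> L, Th L M f \<turnstile> Imp ?\<theta> (Neg \<phi>)"
    if "\<phi> \<in> Fm_upto L ?n" for \<phi>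
    using complete_Th closed that len by (intro isolating_fm_decides) auto
  ultimately have "complete_in L (Th L M f) ?n ?\<theta>" by (simp add: complete_in_def)
  with \<theta> sat show "\<exists>\<theta> \<in> Fm_upto L ?n. satisfied_by M f \<theta> ms \<and> complete_in L (Th L M f) ?n \<theta>"
    by blast
qed

end
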